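(* Let $f$ be any topologically transitive interval exchange transformation on $[0,1)$ and let $m$ be Lebesgue measure. Suppose $\mu\in\mathcal{M}_I(f)$ with $\mu\neq m$. Then the following hold: (i) the density of $\mu$ is a simple function (i.e., a linear combination of finitely many characteristic functions); (ii) any representative $\varphi$ of the equivalence class $\frac{d\mu}{dm}$ is discontinuous everywhere, and $\operatorname{supp}\mu=[0,1)$.
   Context: An interval exchange transformation (IET) on $I=[0,1)$ is a map $f$ of $I$ onto itself for which there are a finite partition $0=\beta_0<\beta_1<\dots<\beta_r=1$ and real numbers $\gamma_i$ with $f(x)=x+\gamma_i$ for $\beta_{i-1}\le x<\beta_i$. Topologically transitive means that for any nonempty open sets $U,V$ there exists $n\in\mathbb{Z}$ with $f^n(U)\cap V\ne\emptyset$. $\mathcal{M}_I(f)$ is the set of $f$-invariant Borel probability measures absolutely continuous with respect to $m$. $x\in\operatorname{supp}\mu$ means that $\mu(B_x)>0$ for every open ball $B_x$ containing $x$. *)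

theory Defs
  imports "HOL-Probability.Probability"
begin

abbreviation unit_ivl :: "real set" where
  "unit_ivl \<equiv> {0..<1}"

abbreviation leb :: "real measure" where
  "leb \<equiv> restrict_space lborel unit_ivl"

text \<open>The values of the map outside the interval are irrelevant.\<close>

definition interval_exchange :: "(real \<Rightarrow> real) \<Rightarrow> bool" where
  "interval_exchange f \<longleftrightarrow>
     f ` unit_ivl = unit_ivl \<and>
     (\<exists>(r::nat) (\<beta>::nat \<Rightarrow> real) (\<gamma>::nat \<Rightarrow> real).
        \<beta> 0 = 0 \<and> \<beta> r = 1 \<and> (\<forall>i<r. \<beta> i < \<beta> (Suc i)) \<and>
        (\<forall>i\<in>{1..r}. \<forall>x. \<beta> (i - 1) \<le> x \<and> x < \<beta> i \<longrightarrow> f x = x + \<gamma> i))"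

text \<open>An interval exchange is a piecewise translation of the interval onto itself, hence
  bijective there, so \<open>inv_into unit_ivl f\<close> is its genuine inverse.\<close>

definition int_iterate :: "(real \<Rightarrow> real) \<Rightarrow> int \<Rightarrow> real \<Rightarrow> real" where
  "int_iterate f n =
     (if n \<ge> 0 then f ^^ nat n else inv_into unit_ivl f ^^ nat (- n))"

definition topologically_transitive :: "(real \<Rightarrow> real) \<Rightarrow> bool" where
  "topologically_transitive f \<longleftrightarrow>
     (\<forall>U V. openin (top_of_set unit_ivl) U \<and> U \<noteq> {} \<and>
            openin (top_of_set unit_ivl) V \<and> V \<noteq> {} \<longrightarrow>
            (\<exists>n::int. int_iterate f n ` U \<inter> V \<noteq> {}))"

definition ac_invariant_measures :: "(real \<Rightarrow> real) \<Rightarrow> real measure set" where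
  "ac_invariant_measures f =
     {\<mu>. sets \<mu> = sets (restrict_space borel unit_ivl) \<and> prob_space \<mu> \<and>
         absolutely_continuous leb \<mu> \<and>
         f \<in> measurable \<mu> \<mu> \<and> distr \<mu> \<mu> f = \<mu>}"

text \<open>The equivalence class of the density, as finite real functions modulo equality almost
  everywhere. A representative may be changed arbitrarily (even to negative values, and without
  staying Borel measurable) on a null set. For absolutely continuous probability measures
  \<^const>\<open>RN_deriv\<close> is finite almost everywhere, so \<^const>\<open>enn2real\<close> loses nothing.\<close>

definition density_class :: "real measure \<Rightarrow> (real \<Rightarrow> real) set" where
  "density_class \<mu> = {\<phi>. AE x in leb. \<phi> x = enn2real (RN_deriv leb \<mu> x)}"

definition measure_support :: "real measure \<Rightarrow> real set" where
  "measure_support \<mu> =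
     {x \<in> unit_ivl. \<forall>c\<in>unit_ivl. \<forall>\<epsilon>. x \<in> ball c \<epsilon> \<longrightarrow> emeasure \<mu> (ball c \<epsilon> \<inter> unit_ivl) > 0}"

end

theory Submission
  imports Defs
begin

text \<open>The primitive \<open>h(x) = \<integral>\<^sub>0\<^sup>x g\<close> of an invariant density satisfies
  \<open>h(x + \<gamma>\<^sub>i) = h(x) + D\<^sub>i\<close> on the \<open>i\<close>-th piece, with constants \<open>D\<^sub>i\<close> depending linearly on \<open>g\<close>. If
  all \<open>D\<^sub>i\<close> vanish then \<open>h\<close> is a continuous invariant function, hence constant by transitivity, and
  \<open>g = 0\<close>; so the invariant densities form a space of dimension at most the number \<open>r\<close> of pieces.
  For a density \<open>\<phi>\<close> the functions \<open>(\<phi> / (1 + \<phi>))\<^sup>k\<close>, \<open>k \<le> r\<close>, are therefore linearly dependent, which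
  makes \<open>\<phi> / (1 + \<phi>)\<close> a root of a fixed polynomial almost everywhere: \<open>\<phi>\<close> takes finitely many values.

  A nonnegative invariant density vanishing on an interval is zero: otherwise its primitive has
  maximal plateaus, there are finitely many of each length, and those of a length that no plateau
  touching a discontinuity has are permuted by the map (if there are only finitely many plateaus,
  take all). Their union is invariant, hence dense, so finitely many plateaus fill the interval.
  Both claims of (ii) follow, for discontinuity by considering the indicator of \<open>{\<phi> \<noteq> c}\<close>.\<close>

section \<open>Linear algebra: homogeneous systems with more unknowns than equations\<close>

text \<open>Gaussian elimination by induction on the number of equations: a nonzero last row is
  solved for one unknown \<open>k0\<close>, which is substituted into the other rows. It later
  serves to combine \<open>r + 1\<close> functions so that \<open>r\<close> displacements
  vanish.\<close>

lemma homogeneous_system_nontrivial_solution: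
  fixes A :: "nat \<Rightarrow> 'b \<Rightarrow> 'a::field"
  assumes "finite S" "card S > r"
  shows "\<exists>c. (\<exists>k\<in>S. c k \<noteq> 0) \<and> (\<forall>i<r. (\<Sum>k\<in>S. A i k * c k) = 0)"
  using assms
proof (induction r arbitrary: S A)
  case 0
  then obtain k where "k \<in> S" by fastforce
  then show ?case by (intro exI[of _ "\<lambda>_. 1"]) auto
next
  case (Suc r)
  show ?case
  proof (cases "\<forall>k\<in>S. A r k = 0")
    case True
    with Suc.IH[of S A] Suc.prems show ?thesis
      by (auto simp: less_Suc_eq)
  next
    case False
    then obtain k0 where k0: "k0 \<in> S" "A r k0 \<noteq> 0" by blast
    define B where "B i k = A i k - A i k0 * A r k / A r k0" for i k
    have "card (S - {k0}) > r" "finite (S - {k0})"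
      using Suc.prems k0 by simp_all
    with Suc.IH[of "S - {k0}" B] obtain c
      where c: "\<exists>k\<in>S - {k0}. c k \<noteq> 0" "\<And>i. i < r \<Longrightarrow> (\<Sum>k\<in>S - {k0}. B i k * c k) = 0"
      by auto
    define s where "s i = (\<Sum>k\<in>S - {k0}. A i k * c k)" for i
    \<comment> \<open>Back substitution: row \<open>r\<close> forces the value at
      \<open>k0\<close>.\<close>
    define d where "d = c(k0 := - s r / A r k0)"
    have sum_d: "(\<Sum>k\<in>S. A i k * d k) = s i - A i k0 * s r / A r k0" for i
    proof -
      have "(\<Sum>k\<in>S. A i k * d k) = A i k0 * d k0 + (\<Sum>k\<in>S - {k0}. A i k * d k)"
        using Suc.prems(1) k0(1) by (rule sum.remove)
      also have "(\<Sum>k\<in>S - {k0}. A i k * d k) = s i"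
        unfolding s_def d_def by (intro sum.cong) auto
      finally show ?thesis by (simp add: d_def)
    qed
    have B_eq: "(\<Sum>k\<in>S - {k0}. B i k * c k) = s i - A i k0 * s r / A r k0" for i
      unfolding B_def s_def
      by (simp add: left_diff_distrib sum_subtractf sum_distrib_left sum_divide_distrib mult.assoc)
    have "(\<Sum>k\<in>S. A i k * d k) = 0" if "i < Suc r" for i
    proof (cases "i = r")
      case True
      then show ?thesis using k0(2) sum_d[of r] by simp
    next
      case False
      then show ?thesis using c(2)[of i] that sum_d[of i] B_eq[of i] by simp
    qed
    moreover have "\<exists>k\<in>S. d k \<noteq> 0"
      using c(1) by (auto simp: d_def)
    ultimately show ?thesis by blast
  qed
qed

section \<open>Pieces and translations of an interval exchange\<close>

locale interval_exchange_data =
  fixes f :: "real \<Rightarrow> real" and r :: nat and \<beta> \<gamma> :: "nat \<Rightarrow> real"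
  assumes surj: "f ` unit_ivl = unit_ivl"
    and beta_0: "\<beta> 0 = 0" and beta_r: "\<beta> r = 1"
    and beta_less_Suc: "i < r \<Longrightarrow> \<beta> i < \<beta> (Suc i)"
    and translation: "\<lbrakk>i < r; \<beta> i \<le> x; x < \<beta> (Suc i)\<rbrakk> \<Longrightarrow> f x = x + \<gamma> i"
begin

lemma maps_to: "x \<in> unit_ivl \<Longrightarrow> f x \<in> unit_ivl"
  using surj by blast

lemma funpow_maps_to: "x \<in> unit_ivl \<Longrightarrow> (f ^^ n) x \<in> unit_ivl"
  by (induction n) (auto simp del: atLeastLessThan_iff intro: maps_to)

lemma beta_mono: "i \<le> j \<Longrightarrow> j \<le> r \<Longrightarrow> \<beta> i \<le> \<beta> j"
proof (induction rule: dec_induct)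
  case (step n)
  then show ?case using beta_less_Suc[of n] by simp
qed simp

lemma beta_bounds: "i \<le> r \<Longrightarrow> 0 \<le> \<beta> i \<and> \<beta> i \<le> 1"
  using beta_mono[of 0 i] beta_mono[of i r] by (simp add: beta_0 beta_r)

lemma piece_cases:
  assumes "x \<in> unit_ivl"
  obtains i where "i < r" "\<beta> i \<le> x" "x < \<beta> (Suc i)"
proof -
  have "\<exists>i<n. \<beta> i \<le> x \<and> x < \<beta> (Suc i)" if "x < \<beta> n" for n
    using that
  proof (induction n)
    case 0
    then show ?case using assms by (simp add: beta_0)
  next
    case (Suc n)
    then show ?case by (cases "x < \<beta> n") (auto intro: less_SucI)
  qed
  from this[of r] that assms show thesis by (auto simp: beta_r)
qed

lemma piece_in_unit: "\<lbrakk>i < r; \<beta> i \<le> x; x < \<beta> (Suc i)\<rbrakk> \<Longrightarrow> x \<in> unit_ivl"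
  using beta_bounds[of i] beta_bounds[of "Suc i"] by auto

lemma shift_in_unit:
  assumes "i < r" "\<beta> i \<le> x" "x < \<beta> (Suc i)"
  shows "x + \<gamma> i \<in> unit_ivl"
  using maps_to[OF piece_in_unit[OF assms]] translation[OF assms] by simp

text \<open>The right endpoint is not in piece \<open>i\<close>, so its bound comes as a limit of
  interior points. Closed pieces are wanted because primitives are evaluated at both ends.\<close>

lemma shift_bounds:
  assumes "i < r" "\<beta> i \<le> x" "x \<le> \<beta> (Suc i)"
  shows "0 \<le> x + \<gamma> i \<and> x + \<gamma> i \<le> 1"
proof -
  have lower: "0 \<le> \<beta> i + \<gamma> i"
    using shift_in_unit[of i "\<beta> i"] beta_less_Suc[of i] assms by simp
  have "\<beta> (Suc i) + \<gamma> i \<le> 1"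
  proof (rule dense_le_bounded[of "\<beta> i + \<gamma> i"])
    fix w assume "\<beta> i + \<gamma> i < w" "w < \<beta> (Suc i) + \<gamma> i"
    then show "w \<le> 1" using shift_in_unit[of i "w - \<gamma> i"] assms by simp
  qed (use beta_less_Suc[of i] assms in simp)
  with lower assms show ?thesis by simp
qed

end

section \<open>Consequences of topological transitivity\<close>

locale transitive_interval_exchange = interval_exchange_data +
  assumes transitive: "topologically_transitive f"
begin

text \<open>Trades two-sided iterates for forward ones: if a backward iterate takes \<open>u\<close>
  to \<open>v\<close>, then a forward iterate takes \<open>v\<close> to \<open>u\<close>.\<close>

lemma transitive_orbit:
  assumes "openin (top_of_set unit_ivl) U" "U \<noteq> {}" "openin (top_of_set unit_ivl) V" "V \<noteq> {}"
  obtains u v n where "u \<in> U" "v \<in> V" "(f ^^ n) u = v \<or> (f ^^ n) v = u"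
proof -
  obtain n :: int where n: "int_iterate f n ` U \<inter> V \<noteq> {}"
    using transitive assms unfolding topologically_transitive_def by blast
  then obtain u where u: "u \<in> U" "int_iterate f n u \<in> V" by blast
  have uI: "u \<in> unit_ivl" using assms(1) u(1) openin_imp_subset by blast
  show thesis
  proof (cases "n \<ge> 0")
    case True
    then show thesis using u that[of u "(f ^^ nat n) u" "nat n"] by (simp add: int_iterate_def)
  next
    case False
    let ?g = "inv_into unit_ivl f"
    have inv: "y \<in> unit_ivl \<Longrightarrow> ?g y \<in> unit_ivl \<and> f (?g y) = y" for y
      using surj by (metis f_inv_into_f inv_into_into)
    have "(?g ^^ k) u \<in> unit_ivl \<and> (f ^^ k) ((?g ^^ k) u) = u" for k
    proof (induction k)
      case (Suc k)
      then show ?case using inv[of "(?g ^^ k) u"] by (simp add: funpow_swap1 del: atLeastLessThan_iff)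
    qed (use uI in simp)
    then show thesis using u that[of u "(?g ^^ nat (-n)) u" "nat (-n)"] False
      by (simp add: int_iterate_def)
  qed
qed

text \<open>Membership in \<open>R\<close> is constant along orbits, and some orbit links
  \<open>U\<close> to \<open>V\<close>. So an invariant set containing a nonempty open set is dense;
  \<open>R\<close> itself may be arbitrary.\<close>

lemma open_sets_invariant:
  assumes "openin (top_of_set unit_ivl) U" "U \<noteq> {}" "openin (top_of_set unit_ivl) V" "V \<noteq> {}"
    and inv: "\<And>x. x \<in> unit_ivl \<Longrightarrow> f x \<in> R \<longleftrightarrow> x \<in> R"
    and "U \<subseteq> R"
  shows "V \<inter> R \<noteq> {}"
proof -
  from transitive_orbit[OF assms(1-4)] obtain u v n
    where uv: "u \<in> U" "v \<in> V" "(f ^^ n) u = v \<or> (f ^^ n) v = u" by blast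
  have "u \<in> unit_ivl" "v \<in> unit_ivl"
    using uv assms(1,3) openin_imp_subset by blast+
  moreover have "(f ^^ k) x \<in> R \<longleftrightarrow> x \<in> R" if "x \<in> unit_ivl" for k x
    by (induction k) (use inv funpow_maps_to[OF that] in \<open>auto simp del: atLeastLessThan_iff\<close>)
  ultimately have "v \<in> R" using uv \<open>U \<subseteq> R\<close> by blast
  then show ?thesis using uv by blast
qed

text \<open>A number \<open>c\<close> strictly between two values of \<open>h\<close> would give
  disjoint nonempty open sets \<open>h < c\<close> and \<open>h > c\<close>, the first one
  invariant.\<close>

lemma continuous_invariant_constant:
  fixes h :: "real \<Rightarrow> real"
  assumes cont: "continuous_on unit_ivl h"
    and inv: "\<And>x. x \<in> unit_ivl \<Longrightarrow> h (f x) = h x"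
    and "x \<in> unit_ivl" "y \<in> unit_ivl"
  shows "h x = h y"
proof -
  have False if xy: "x \<in> unit_ivl" "y \<in> unit_ivl" "h x < h y" for x y
  proof -
    obtain c where c: "h x < c" "c < h y" using dense xy(3) by blast
    let ?U = "unit_ivl \<inter> h -` {..<c}" and ?V = "unit_ivl \<inter> h -` {c<..}"
    have "openin (top_of_set unit_ivl) ?U" "openin (top_of_set unit_ivl) ?V"
      using cont by (auto intro!: continuous_openin_preimage_gen)
    moreover have "?U \<noteq> {}" "?V \<noteq> {}" using xy c by auto
    ultimately have "?V \<inter> h -` {..<c} \<noteq> {}"
      by (intro open_sets_invariant[of ?U ?V "h -` {..<c}"]) (use inv in auto)
    then show False by auto
  qed
  then show ?thesis using assms by (metis linorder_neqE)
qed

end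

subsection \<open>Plateaus of monotone functions with constant increments\<close>

text \<open>For monotone \<open>h\<close>, equal end values force constancy in between, and the
  strict inequalities express maximality: a plateau is a nondegenerate full level set.\<close>

definition plateau :: "(real \<Rightarrow> real) \<Rightarrow> real \<Rightarrow> real \<Rightarrow> bool" where
  "plateau h a b \<longleftrightarrow> 0 \<le> a \<and> a < b \<and> b \<le> 1 \<and> h a = h b \<and>
     (\<forall>x. 0 \<le> x \<and> x < a \<longrightarrow> h x < h a) \<and> (\<forall>x. b < x \<and> x \<le> 1 \<longrightarrow> h b < h x)"

context
  fixes h :: "real \<Rightarrow> real"
  assumes mono: "mono_on {0..1} h"
begin

lemma plateau_constant:
  assumes "plateau h a b" "a \<le> x" "x \<le> b"
  shows "h x = h a"
  using mono_onD[OF mono, of a x] mono_onD[OF mono, of x b] assms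
  by (auto simp: plateau_def)

text \<open>Both plateaus carry the value of \<open>h\<close> at \<open>x\<close>, and each is the
  whole level set of that value.\<close>

lemma plateau_unique:
  assumes "plateau h a b" "plateau h a' b'" "a \<le> x" "x \<le> b" "a' \<le> x" "x \<le> b'"
  shows "a = a'" "b = b'"
proof -
  have "h a = h a'"
    using plateau_constant[of a b x] plateau_constant[of a' b' x] assms by simp
  with assms show "a = a'" "b = b'"
    unfolding plateau_def by (metis less_le_trans linorder_neqE order.trans order_less_imp_le order_less_irrefl)+
qed

text \<open>The level set of \<open>h x\<close> is compact; its minimum and maximum are the ends of
  the plateau.\<close>

lemma plateau_exists:
  assumes cont: "continuous_on {0..1} h"
    and xy: "0 \<le> x" "x < y" "y \<le> 1" "h x = h y"
  obtains a b where "plateau h a b" "a \<le> x" "y \<le> b"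
proof -
  define K where "K = {0..1} \<inter> h -` {h x}"
  have "compact K"
    unfolding K_def using cont
    by (metis closed_singleton compact_Int_closed compact_Icc continuous_on_closed_vimage
        closed_real_atLeastAtMost compact_eq_bounded_closed bounded_Int bounded_closed_interval Int_commute)
  moreover have "x \<in> K" "y \<in> K" using xy by (auto simp: K_def)
  ultimately obtain a b where a: "a \<in> K" "\<And>t. t \<in> K \<Longrightarrow> a \<le> t" and b: "b \<in> K" "\<And>t. t \<in> K \<Longrightarrow> t \<le> b"
    using compact_attains_inf[of K] compact_attains_sup[of K] by blast
  have K: "t \<in> K \<longleftrightarrow> 0 \<le> t \<and> t \<le> 1 \<and> h t = h x" for t by (auto simp: K_def)
  have ab: "a \<le> x" "y \<le> b" using a b \<open>x \<in> K\<close> \<open>y \<in> K\<close> by auto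
  moreover have "plateau h a b"
    unfolding plateau_def
  proof (intro conjI allI impI)
    fix t assume "0 \<le> t \<and> t < a"
    then show "h t < h a"
      using a(2)[of t] mono_onD[OF mono, of t a] a(1) unfolding K by force
  next
    fix t assume "b < t \<and> t \<le> 1"
    then show "h b < h t"
      using b(2)[of t] mono_onD[OF mono, of b t] b(1) unfolding K by force
  qed (use ab a(1) b(1) xy in \<open>auto simp: K\<close>)
  ultimately show thesis using that by blast
qed

text \<open>Distinct plateaus are disjoint, so left ends of long ones are more than \<open>l\<close>
  apart and are told apart by the integer part of \<open>a / l\<close>.\<close>

lemma finite_long_plateaus:
  assumes "l > 0"
  shows "finite {(a, b). plateau h a b \<and> l \<le> b - a}" (is "finite ?P")
proof (rule finite_imageD)
  let ?g = "\<lambda>p::real \<times> real. \<lfloor>fst p / l\<rfloor>"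
  have "?g ` ?P \<subseteq> {0..\<lfloor>1 / l\<rfloor>}"
    using assms by (auto simp: plateau_def intro!: floor_mono divide_right_mono)
  then show "finite (?g ` ?P)" using finite_subset by blast
  have less: "?g (a, b) < ?g (a', b')" if "plateau h a b" "plateau h a' b'" "l \<le> b - a" "a < a'" for a b a' b'
  proof -
    have "b < a'"
      using plateau_unique(1)[OF that(1,2), of a'] that by (force simp: plateau_def)
    then have "(a + l) / l \<le> a' / l" using assms that by (intro divide_right_mono) auto
    then have "a / l + 1 \<le> a' / l" using assms by (simp add: add_divide_distrib)
    then show ?thesis by (simp, linarith)
  qed
  show "inj_on ?g ?P"
  proof (rule inj_onI, clarify, goal_cases)
    case (1 a b a' b')
    then have "a = a'" using less[of a b a' b'] less[of a' b' a b] by force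
    with 1 show ?case using plateau_unique(2)[of a b a' b' a] by (force simp: plateau_def)
  qed
qed

text \<open>A point of \<open>S\<close> lies on at most one plateau. For points on none, the choice
  \<open>p s\<close> is arbitrary and harmless, as only an inclusion is shown.\<close>

lemma finite_plateaus_meeting:
  assumes "finite S"
  shows "finite {(a, b). plateau h a b \<and> {a..b} \<inter> S \<noteq> {}}" (is "finite ?P")
proof -
  define p where "p s = (SOME ab. plateau h (fst ab) (snd ab) \<and> s \<in> {fst ab..snd ab})" for s
  have "?P \<subseteq> p ` S"
  proof (intro subsetI, clarsimp simp del: atLeastAtMost_iff simp: ex_in_conv[symmetric])
    fix a b s assume ab: "plateau h a b" "s \<in> {a..b}" "s \<in> S"
    have "plateau h (fst (p s)) (snd (p s)) \<and> s \<in> {fst (p s)..snd (p s)}"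
      unfolding p_def by (rule someI[of _ "(a, b)"]) (use ab in simp)
    then have "p s = (a, b)"
      using plateau_unique[of a b "fst (p s)" "snd (p s)" s] ab by (auto intro: prod_eqI)
    with ab show "(a, b) \<in> p ` S" by force
  qed
  with assms show ?thesis by (meson finite_imageI finite_subset)
qed

text \<open>The relation between \<open>h\<close> and its translate is known only on
  \<open>[c, d]\<close>. Since \<open>[a, b]\<close> lies strictly inside, maximality of the plateau
  is visible within this range and is carried over; monotonicity handles points outside the
  translated range.\<close>

lemma plateau_shift:
  assumes ab: "plateau h a b" and cd: "c < a" "b < d"
    and bounds: "0 \<le> c + t" "d + t \<le> 1"
    and shift: "\<And>x. c \<le> x \<Longrightarrow> x \<le> d \<Longrightarrow> 0 \<le> x \<and> x \<le> 1 \<and> h (x + t) = h x + D"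
  shows "plateau h (a + t) (b + t)"
  unfolding plateau_def
proof (intro conjI allI impI)
  have ab': "a < b" using ab by (simp add: plateau_def)
  fix x assume x: "0 \<le> x \<and> x < a + t"
  \<comment> \<open>The point \<open>x\<close> shifted back, clipped to stay in
    \<open>[c, d]\<close> where the relation applies.\<close>
  define y where "y = max (x - t) c"
  have "h x \<le> h (y + t)"
    using mono_onD[OF mono, of x "y + t"] x ab' cd bounds by (auto simp: y_def)
  also have "\<dots> = h y + D" using shift[of y] x ab' cd by (auto simp: y_def)
  also have "h y < h a"
    using ab shift[of y] x ab' cd by (auto simp: y_def plateau_def max_def)
  also have "h a + D = h (a + t)" using shift[of a] ab' cd by simp
  finally show "h x < h (a + t)" by simp
next
  have ab': "a < b" using ab by (simp add: plateau_def)
  fix x assume x: "b + t < x \<and> x \<le> 1"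
  define y where "y = min (x - t) d"
  have "h (b + t) = h b + D" using shift[of b] ab' cd by simp
  also have "h b < h y"
    using ab shift[of y] x ab' cd by (auto simp: y_def plateau_def min_def)
  also have "h y + D = h (y + t)" using shift[of y] x ab' cd by (auto simp: y_def)
  also have "\<dots> \<le> h x"
    using mono_onD[OF mono, of "y + t" x] x ab' cd bounds by (auto simp: y_def)
  finally show "h (b + t) < h x" by simp
qed (use assms(1-5) shift[of a] shift[of b] in \<open>auto simp: plateau_def\<close>)

end

section \<open>Plateaus under a transitive interval exchange\<close>

context transitive_interval_exchange
begin

text \<open>A plateau avoiding the piece endpoints lies strictly inside any piece it meets, so its
  image is a plateau; avoiding the translated endpoints gives the same for its preimage.\<close>

definition singular_points :: "real set" where
  "singular_points = \<beta> ` {..r} \<union> (\<lambda>i. \<beta> i + \<gamma> i) ` {..<r} \<union> (\<lambda>i. \<beta> (Suc i) + \<gamma> i) ` {..<r}"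

context
  fixes h :: "real \<Rightarrow> real" and D :: "nat \<Rightarrow> real"
  assumes cont: "continuous_on {0..1} h"
    and mono: "mono_on {0..1} h"
    and cocycle: "\<lbrakk>i < r; \<beta> i \<le> x; x \<le> \<beta> (Suc i)\<rbrakk> \<Longrightarrow> h (x + \<gamma> i) = h x + D i"
begin

text \<open>The invariant union contains an open interval, so it is dense, and finitely many closed
  plateaus then cover the interval. Thus \<open>h\<close> has finitely many values, and a finite
  connected set of values is a single point.\<close>

lemma constant_if_finite_invariant_plateaus:
  assumes fin: "finite P" and ne: "P \<noteq> {}" and pl: "\<And>a b. (a, b) \<in> P \<Longrightarrow> plateau h a b"
    and inv: "\<And>x. x \<in> unit_ivl \<Longrightarrow> f x \<in> (\<Union>(a, b)\<in>P. {a..<b}) \<longleftrightarrow> x \<in> (\<Union>(a, b)\<in>P. {a..<b})"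
  shows "h 0 = h 1"
proof -
  obtain a0 b0 where p0: "(a0, b0) \<in> P" using ne by auto
  \<comment> \<open>The closed version \<open>?K\<close> has an open complement; the half-open
    version \<open>?R\<close> matches the half-open pieces and is the invariant one.\<close>
  let ?K = "\<Union>(a, b)\<in>P. {a..b}" and ?R = "\<Union>(a, b)\<in>P. {a..<b}"
  let ?U = "{a0<..<b0}"
  have "closed ?K" using fin by (intro closed_UN) auto
  then have openV: "openin (top_of_set unit_ivl) (unit_ivl - ?K)"
    by (metis Diff_eq open_Compl openin_open)
  have U: "?U \<subseteq> unit_ivl" "?U \<noteq> {}" using pl[OF p0] by (auto simp: plateau_def)
  have openU: "openin (top_of_set unit_ivl) ?U"
    using U(1) open_subset[of ?U unit_ivl] by auto
  have "unit_ivl - ?K = {}"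
  proof (rule ccontr)
    assume "unit_ivl - ?K \<noteq> {}"
    with openU U(2) openV have "(unit_ivl - ?K) \<inter> ?R \<noteq> {}"
      by (intro open_sets_invariant[of ?U "unit_ivl - ?K" ?R] inv) (use p0 in force)+
    then show False by force
  qed
  moreover have "h x \<in> (h \<circ> fst) ` P" if "(a, b) \<in> P" "x \<in> {a..b}" for a b x
    using plateau_constant[OF mono pl[OF that(1)], of x] that by (auto intro!: image_eqI[of _ _ "(a, b)"])
  ultimately have "h ` unit_ivl \<subseteq> (h \<circ> fst) ` P"
    by blast
  then have "finite (h ` unit_ivl)" using fin by (meson finite_imageI finite_subset)
  moreover have "{0..1} = insert 1 unit_ivl" by auto
  ultimately have "finite (h ` {0..1})" by simp
  moreover have "connected (h ` {0..1})" using cont by (intro connected_continuous_image) auto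
  ultimately have "h ` {0..1} = {} \<or> (\<exists>c. h ` {0..1} = {c})"
    using connected_finite_iff_sing[of "h ` {0..1}"] by simp
  then obtain c where "h ` {0..1} = {c}" by auto
  then have "h 0 \<in> {c}" "h 1 \<in> {c}" by (metis atLeastAtMost_iff imageI order_refl zero_le_one)+
  then show ?thesis by simp
qed

text \<open>Lying on a half-open plateau means that \<open>h\<close> is flat immediately to the
  right. This is preserved both ways, because immediately to the right of any point \<open>f\<close>
  is a translation under which \<open>h\<close> changes by a constant.\<close>

lemma plateau_points_invariant:
  assumes x: "x \<in> unit_ivl"
  shows "f x \<in> (\<Union>(a, b)\<in>{(a, b). plateau h a b}. {a..<b}) \<longleftrightarrow>
         x \<in> (\<Union>(a, b)\<in>{(a, b). plateau h a b}. {a..<b})"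
proof -
  have char: "t \<in> (\<Union>(a, b)\<in>{(a, b). plateau h a b}. {a..<b}) \<longleftrightarrow> (\<exists>y>t. y \<le> 1 \<and> h y = h t)"
    (is "_ \<longleftrightarrow> ?right_flat t") if "t \<in> unit_ivl" for t
  proof
    assume "?right_flat t"
    then obtain y where y: "t < y" "y \<le> 1" "h y = h t" by blast
    with that obtain a b where "plateau h a b" "a \<le> t" "y \<le> b"
      using plateau_exists[OF mono cont, of t y] by auto
    with y show "t \<in> (\<Union>(a, b)\<in>{(a, b). plateau h a b}. {a..<b})" by force
  next
    assume "t \<in> (\<Union>(a, b)\<in>{(a, b). plateau h a b}. {a..<b})"
    then obtain a b where "plateau h a b" "a \<le> t" "t < b" by auto
    then show "?right_flat t"
      using plateau_constant[OF mono, of a b t] by (intro exI[of _ b]) (auto simp: plateau_def)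
  qed
  have closer: "h z = h t" if "t \<in> unit_ivl" "t < z" "z \<le> y" "y \<le> 1" "h y = h t" for t z y
    using mono_onD[OF mono, of t z] mono_onD[OF mono, of z y] that by auto
  obtain i where i: "i < r" "\<beta> i \<le> x" "x < \<beta> (Suc i)" using piece_cases[OF x] by blast
  have fx: "f x = x + \<gamma> i" using translation[OF i] .
  have "(\<exists>y>x. y \<le> 1 \<and> h y = h x) \<longleftrightarrow> (\<exists>y>f x. y \<le> 1 \<and> h y = h (f x))"
  proof safe
    fix y assume y: "x < y" "y \<le> 1" "h y = h x"
    \<comment> \<open>Clipping at the right end of the piece keeps the witness beyond
      \<open>x\<close> and within reach of the cocycle relation, which includes that end.\<close>
    let ?z = "min y (\<beta> (Suc i))"
    have "h ?z = h x" by (rule closer[of _ _ y]) (use x y i in auto)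
    then show "\<exists>y>f x. y \<le> 1 \<and> h y = h (f x)"
      using cocycle[of i ?z] cocycle[of i x] shift_bounds[of i ?z] i y fx
      by (intro exI[of _ "?z + \<gamma> i"]) auto
  next
    fix y assume y: "f x < y" "y \<le> 1" "h y = h (f x)"
    let ?z = "min y (\<beta> (Suc i) + \<gamma> i)"
    have "h ?z = h (f x)" by (rule closer[of _ _ y]) (use maps_to[OF x] y i fx in auto)
    then show "\<exists>y>x. y \<le> 1 \<and> h y = h x"
      using cocycle[of i "?z - \<gamma> i"] cocycle[of i x] i y fx beta_bounds[of "Suc i"]
      by (intro exI[of _ "?z - \<gamma> i"]) auto
  qed
  then show ?thesis by (simp only: char[OF x] char[OF maps_to[OF x]])
qed

lemma regular_plateau_image:
  assumes ab: "plateau h a b" "{a..b} \<inter> singular_points = {}"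
    and i: "i < r" "\<beta> i \<le> x" "x < \<beta> (Suc i)" and x: "x \<in> {a..<b}"
  shows "plateau h (a + \<gamma> i) (b + \<gamma> i)"
proof (rule plateau_shift[OF mono ab(1)])
  have "\<beta> i \<notin> {a..b}" "\<beta> (Suc i) \<notin> {a..b}" using ab(2) i(1) unfolding singular_points_def by auto
  then show "\<beta> i < a" "b < \<beta> (Suc i)" using i x by auto
  show "0 \<le> \<beta> i + \<gamma> i" "\<beta> (Suc i) + \<gamma> i \<le> 1"
    using shift_bounds[of i "\<beta> i"] shift_bounds[of i "\<beta> (Suc i)"] i by auto
  show "0 \<le> t \<and> t \<le> 1 \<and> h (t + \<gamma> i) = h t + D i" if "\<beta> i \<le> t" "t \<le> \<beta> (Suc i)" for t
    using cocycle[of i t] beta_bounds[of i] beta_bounds[of "Suc i"] that i by auto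
qed

lemma regular_plateau_preimage:
  assumes ab: "plateau h a b" "{a..b} \<inter> singular_points = {}"
    and i: "i < r" "\<beta> i \<le> x" "x < \<beta> (Suc i)" and x: "x + \<gamma> i \<in> {a..<b}"
  shows "plateau h (a - \<gamma> i) (b - \<gamma> i)"
proof -
  have "\<beta> i + \<gamma> i \<notin> {a..b}" "\<beta> (Suc i) + \<gamma> i \<notin> {a..b}"
    using ab(2) i(1) unfolding singular_points_def by auto
  then have "\<beta> i + \<gamma> i < a" "b < \<beta> (Suc i) + \<gamma> i" using i x by auto
  then have "plateau h (a + (- \<gamma> i)) (b + (- \<gamma> i))"
  proof (rule plateau_shift[OF mono ab(1)])
    show "0 \<le> \<beta> i + \<gamma> i + - \<gamma> i" "\<beta> (Suc i) + \<gamma> i + - \<gamma> i \<le> 1"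
      using beta_bounds[of i] beta_bounds[of "Suc i"] i by auto
    show "0 \<le> t \<and> t \<le> 1 \<and> h (t + - \<gamma> i) = h t + - D i" if "\<beta> i + \<gamma> i \<le> t" "t \<le> \<beta> (Suc i) + \<gamma> i" for t
      using cocycle[of i "t - \<gamma> i"] shift_bounds[of i "t - \<gamma> i"] that i by auto
  qed
  then show ?thesis by simp
qed

lemma flat_somewhere_imp_constant:
  assumes xy: "0 \<le> x" "x < y" "y \<le> 1" "h x = h y"
  shows "h 0 = h 1"
proof -
  define G where "G = {(a, b). plateau h a b}"
  have G: "(a, b) \<in> G \<longleftrightarrow> plateau h a b" for a b by (simp add: G_def)
  have ne: "G \<noteq> {}" using plateau_exists[OF mono cont xy] G by blast
  show ?thesis
  proof (cases "finite G")
    case True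
    then show ?thesis
      using constant_if_finite_invariant_plateaus[OF True ne] plateau_points_invariant
      unfolding G_def by auto
  next
    case False
    define Sing where "Sing = {(a, b). plateau h a b \<and> {a..b} \<inter> singular_points \<noteq> {}}"
    have "finite singular_points" unfolding singular_points_def by auto
    then have finS: "finite Sing"
      unfolding Sing_def by (rule finite_plateaus_meeting[OF mono])
    \<comment> \<open>Only finitely many plateaus are at least as long as some member of
      \<open>L\<close>, so an infinite family contains one shorter than all of them.\<close>
    define L where "L = (\<lambda>(a, b). b - a) ` Sing"
    have "finite L" using finS by (simp add: L_def)
    moreover have "finite {(a, b). plateau h a b \<and> l \<le> b - a}" if "l \<in> L" for l
      using that by (intro finite_long_plateaus[OF mono]) (auto simp: L_def Sing_def plateau_def)
    ultimately have "finite (\<Union>l\<in>L. {(a, b). plateau h a b \<and> l \<le> b - a})" by blast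
    with False have "\<not> G \<subseteq> (\<Union>l\<in>L. {(a, b). plateau h a b \<and> l \<le> b - a})"
      using finite_subset by blast
    then obtain a0 b0 where p0: "plateau h a0 b0" "b0 - a0 \<notin> L"
      using G by fast
    define l where "l = b0 - a0"
    \<comment> \<open>No plateau of length \<open>l\<close> touches a singular point, and
      translations preserve length, so images and preimages stay in \<open>P\<close>.\<close>
    define P where "P = {(a, b). plateau h a b \<and> b - a = l}"
    have "l > 0" using p0 by (simp add: l_def plateau_def)
    have "finite P"
      by (rule finite_subset[OF _ finite_long_plateaus[OF mono \<open>l > 0\<close>]]) (auto simp: P_def)
    moreover have "P \<noteq> {}" using p0 by (auto simp: P_def l_def)
    moreover have pl: "plateau h a b" if "(a, b) \<in> P" for a b using that by (simp add: P_def)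
    moreover have "f x \<in> (\<Union>(a, b)\<in>P. {a..<b}) \<longleftrightarrow> x \<in> (\<Union>(a, b)\<in>P. {a..<b})" if x: "x \<in> unit_ivl" for x
    proof -
      have regular: "{a..b} \<inter> singular_points = {}" if "(a, b) \<in> P" for a b
      proof (rule ccontr)
        assume "{a..b} \<inter> singular_points \<noteq> {}"
        then have "(a, b) \<in> Sing" using that by (simp add: Sing_def P_def)
        then have "b - a \<in> L" unfolding L_def by force
        then show False using that p0(2) by (simp add: P_def l_def)
      qed
      obtain i where i: "i < r" "\<beta> i \<le> x" "x < \<beta> (Suc i)" using piece_cases[OF x] by blast
      have fx: "f x = x + \<gamma> i" using translation[OF i] .
      show ?thesis
      proof
        assume "f x \<in> (\<Union>(a, b)\<in>P. {a..<b})"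
        then obtain a b where ab: "(a, b) \<in> P" "x + \<gamma> i \<in> {a..<b}" using fx by auto
        then have "(a - \<gamma> i, b - \<gamma> i) \<in> P"
          using regular_plateau_preimage[OF pl regular i] by (auto simp: P_def)
        then show "x \<in> (\<Union>(a, b)\<in>P. {a..<b})"
          using ab(2) by (intro UN_I[of "(a - \<gamma> i, b - \<gamma> i)"]) auto
      next
        assume "x \<in> (\<Union>(a, b)\<in>P. {a..<b})"
        then obtain a b where ab: "(a, b) \<in> P" "x \<in> {a..<b}" by auto
        then have "(a + \<gamma> i, b + \<gamma> i) \<in> P"
          using regular_plateau_image[OF pl regular i] by (auto simp: P_def)
        then show "f x \<in> (\<Union>(a, b)\<in>P. {a..<b})" 
          using ab(2) fx by (intro UN_I[of "(a + \<gamma> i, b + \<gamma> i)"]) auto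
      qed
    qed
    ultimately show ?thesis by (rule constant_if_finite_invariant_plateaus)
  qed
qed

end

end

subsection \<open>Primitives of invariant densities\<close>

text \<open>The positive and negative parts of \<open>g\<close> are densities of finite measures
  with equal distribution functions, so the measures agree and the two parts coincide almost
  everywhere.\<close>

lemma AE_zero_if_primitive_zero:
  fixes g :: "real \<Rightarrow> real"
  assumes g: "integrable lborel g" and zero: "\<And>x. (LINT t:{..x}|lborel. g t) = 0"
  shows "AE x in lborel. g x = 0"
proof -
  have [measurable]: "g \<in> borel_measurable borel" using g by auto
  have finite_density: "finite_borel_measure (density lborel (\<lambda>x. ennreal (u x)))"
    if "integrable lborel u" for u :: "real \<Rightarrow> real"
  proof -
    have [measurable]: "u \<in> borel_measurable borel" using that by auto
    have "(\<integral>\<^sup>+x. ennreal (u x) \<partial>lborel) < \<infinity>"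
      using that by (simp add: real_integrable_def less_top)
    then show ?thesis
      by (intro finite_borel_measure.intro finite_measureI finite_borel_measure_axioms.intro)
        (simp_all add: emeasure_density)
  qed
  have cdf_eq: "cdf (density lborel (\<lambda>x. ennreal (u x))) x =
      enn2real (\<integral>\<^sup>+t. ennreal (indicator {..x} t *\<^sub>R u t) \<partial>lborel)"
    if "u \<in> borel_measurable borel" for u :: "real \<Rightarrow> real" and x
  proof -
    have "(\<integral>\<^sup>+t. ennreal (u t) * indicator {..x} t \<partial>lborel) = (\<integral>\<^sup>+t. ennreal (indicator {..x} t *\<^sub>R u t) \<partial>lborel)"
      by (intro nn_integral_cong) (auto simp: indicator_def)
    then show ?thesis using that by (simp add: cdf_def measure_def emeasure_density)
  qed
  have "cdf (density lborel (\<lambda>x. ennreal (g x))) = cdf (density lborel (\<lambda>x. ennreal (- g x)))"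
  proof
    fix x
    have "integrable lborel (\<lambda>t. indicator {..x} t *\<^sub>R g t)"
      using g by (intro integrable_mult_indicator) auto
    from real_lebesgue_integral_def[OF this] zero[of x]
    show "cdf (density lborel (\<lambda>x. ennreal (g x))) x = cdf (density lborel (\<lambda>x. ennreal (- g x))) x"
      by (simp add: cdf_eq set_lebesgue_integral_def)
  qed
  then have "density lborel (\<lambda>x. ennreal (g x)) = density lborel (\<lambda>x. ennreal (- g x))"
    using g by (intro cdf_unique' finite_density) auto
  \<comment> \<open>Since \<open>ennreal\<close> truncates negative numbers to 0, one side is always
    0, so equality forces \<open>g x = 0\<close>.\<close>
  then have "AE x in lborel. ennreal (g x) = ennreal (- g x)"
    by (intro sigma_finite_measure.density_unique[OF lborel.sigma_finite_measure_axioms]) auto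
  then show ?thesis
  proof eventually_elim
    case (elim x)
    then show ?case
      by (cases "g x" "0::real" rule: linorder_cases) (auto simp: ennreal_neg ennreal_eq_0_iff)
  qed
qed

definition primitive :: "(real \<Rightarrow> real) \<Rightarrow> real \<Rightarrow> real" where
  "primitive g x = (LINT t:{0..x}|lborel. g t)"

lemma primitive_diff:
  assumes g: "set_integrable lborel {0..1} g" and xy: "0 \<le> x" "x \<le> y" "y \<le> 1"
  shows "primitive g y - primitive g x = (LINT t:{x..y}|lborel. g t)"
proof -
  have sub: "set_integrable lborel {u..v} g" if "0 \<le> u" "v \<le> 1" for u v
    by (rule set_integrable_subset[OF g]) (use that in auto)
  have "integral {0..x} g + integral {x..y} g = integral {0..y} g"
    by (intro Henstock_Kurzweil_Integration.integral_combine set_borel_integral_eq_integral sub) (use xy in auto)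
  then show ?thesis
    unfolding primitive_def using xy by (simp add: set_borel_integral_eq_integral(2)[OF sub])
qed

lemma continuous_on_primitive:
  assumes g: "set_integrable lborel {0..1} g"
  shows "continuous_on {0..1} (primitive g)"
proof -
  have sub: "set_integrable lborel {0..v} g" if "v \<le> 1" for v
    by (rule set_integrable_subset[OF g]) (use that in auto)
  have "continuous_on {0..1} (\<lambda>x. integral {0..x} g)"
    by (intro indefinite_integral_continuous_1 set_borel_integral_eq_integral(1) g)
  then show ?thesis
    by (rule continuous_on_eq) (simp add: primitive_def set_borel_integral_eq_integral(2)[OF sub])
qed

lemma primitive_0: "primitive g 0 = 0"
proof -
  have "primitive g 0 = (LINT t:{}|lborel. g t)"
    unfolding primitive_def by (rule set_integral_discrete_difference[of "{0}"]) auto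
  then show ?thesis by (simp add: set_lebesgue_integral_def)
qed

lemma mono_on_primitive:
  assumes g: "set_integrable lborel {0..1} g" and nonneg: "\<And>x. 0 \<le> g x"
  shows "mono_on {0..1} (primitive g)"
proof (rule mono_onI)
  fix x y :: real assume "x \<in> {0..1}" "y \<in> {0..1}" "x \<le> y"
  moreover have "0 \<le> (LINT t:{x..y}|lborel. g t)"
    unfolding set_lebesgue_integral_def by (intro integral_nonneg_AE) (simp add: nonneg)
  ultimately show "primitive g x \<le> primitive g y"
    using primitive_diff[OF g, of x y] by simp
qed

text \<open>Continuity supplies the value at 1; then \<open>g\<close>, cut off outside
  \<open>[0, 1]\<close>, has zero integral over every half-line.\<close>

lemma AE_unit_if_primitive_zero:
  assumes g: "set_integrable lborel {0..1} g" and zero: "\<And>x. x \<in> unit_ivl \<Longrightarrow> primitive g x = 0"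
  shows "AE x in lborel. x \<in> unit_ivl \<longrightarrow> g x = 0"
proof -
  have one: "primitive g 1 = 0"
  proof -
    have "primitive g ` closure {0<..<1} \<subseteq> {0}"
      by (rule image_closure_subset) (use continuous_on_primitive[OF g] zero in auto)
    then have "primitive g ` {0..1} \<subseteq> {0}" by simp
    then show ?thesis by (simp add: image_subset_iff)
  qed
  let ?G = "\<lambda>x. indicator {0..1} x *\<^sub>R g x"
  have "(LINT t:{..x}|lborel. ?G t) = 0" for x
  proof -
    have "(LINT t:{..x}|lborel. ?G t) = (LINT t:{0..min x 1}|lborel. g t)"
      unfolding set_lebesgue_integral_def
      by (intro Bochner_Integration.integral_cong) (auto simp: indicator_def)
    also have "\<dots> = 0"
    proof (cases "0 \<le> x")
      case True
      then show ?thesis using zero[of x] one by (cases "x < 1") (auto simp: primitive_def)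
    qed (simp add: set_lebesgue_integral_def)
    finally show ?thesis .
  qed
  then have "AE x in lborel. ?G x = 0"
    using g unfolding set_integrable_def by (intro AE_zero_if_primitive_zero)
  then show ?thesis by eventually_elim auto
qed

section \<open>Invariant functions and the cocycle relation of their primitives\<close>

context interval_exchange_data
begin

text \<open>Almost everywhere invariance under \<open>f\<close>, split by pieces so that each
  translation can be substituted in an integral.\<close>

definition shift_invariant :: "(real \<Rightarrow> 'a) \<Rightarrow> bool" where
  "shift_invariant g \<longleftrightarrow>
     (\<forall>i<r. AE x in lborel. \<beta> i \<le> x \<and> x < \<beta> (Suc i) \<longrightarrow> g (x + \<gamma> i) = g x)"

lemma shift_invariant_comp: "shift_invariant g \<Longrightarrow> shift_invariant (\<lambda>x. u (g x))"
  unfolding shift_invariant_def by (auto elim!: eventually_mono)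

text \<open>The constant \<open>D\<close> of the cocycle relation, read off at the left end of the
  piece.\<close>

definition displacement :: "(real \<Rightarrow> real) \<Rightarrow> nat \<Rightarrow> real" where
  "displacement g i = primitive g (\<beta> i + \<gamma> i) - primitive g (\<beta> i)"

text \<open>The increment of the primitive over the translated segment is pulled back by a change of
  variables, and invariance turns it into the increment over the original segment.\<close>

lemma primitive_cocycle:
  fixes g :: "real \<Rightarrow> real"
  assumes [measurable]: "g \<in> borel_measurable borel" and g: "set_integrable lborel {0..1} g"
    and inv: "shift_invariant g"
    and i: "i < r" "\<beta> i \<le> x" "x \<le> \<beta> (Suc i)"
  shows "primitive g (x + \<gamma> i) = primitive g x + displacement g i"
proof -
  have "primitive g (x + \<gamma> i) - primitive g (\<beta> i + \<gamma> i) = (LINT t:{\<beta> i + \<gamma> i..x + \<gamma> i}|lborel. g t)"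
    using shift_bounds[of i x] shift_bounds[of i "\<beta> i"] i by (intro primitive_diff[OF g]) auto
  also have "\<dots> = (LINT t:{\<beta> i..x}|lborel. g (t + \<gamma> i))"
    unfolding set_lebesgue_integral_def
    by (subst lborel_integral_real_affine[where c = 1 and t = "\<gamma> i"])
      (auto intro!: Bochner_Integration.integral_cong simp: indicator_def add.commute)
  also have "\<dots> = (LINT t:{\<beta> i..x}|lborel. g t)"
  proof (rule set_lebesgue_integral_cong_AE)
    have "AE t in lborel. \<beta> i \<le> t \<and> t < \<beta> (Suc i) \<longrightarrow> g (t + \<gamma> i) = g t"
      using inv i by (simp add: shift_invariant_def)
    \<comment> \<open>Invariance is given on the half-open piece; the closed segment may add its
      right end, a null set.\<close>
    moreover have "AE t in lborel. t \<noteq> \<beta> (Suc i)" by (rule AE_lborel_singleton)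
    ultimately show "AE t\<in>{\<beta> i..x} in lborel. g (t + \<gamma> i) = g t"
      by eventually_elim (use i in auto)
  qed auto
  also have "\<dots> = primitive g x - primitive g (\<beta> i)"
    using beta_bounds[of i] beta_bounds[of "Suc i"] i by (intro primitive_diff[OF g, symmetric]) auto
  finally show ?thesis by (simp add: displacement_def)
qed

end

section \<open>Vanishing and finite range of invariant functions\<close>

context transitive_interval_exchange
begin

text \<open>Injectivity of the linear map from invariant densities to their \<open>r\<close>
  displacements, which bounds the dimension.\<close>

lemma AE_zero_if_displacement_zero:
  fixes g :: "real \<Rightarrow> real"
  assumes "g \<in> borel_measurable borel" "set_integrable lborel {0..1} g" "shift_invariant g"
    and zero: "\<And>i. i < r \<Longrightarrow> displacement g i = 0"
  shows "AE x in lborel. x \<in> unit_ivl \<longrightarrow> g x = 0"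
proof (rule AE_unit_if_primitive_zero[OF assms(2)])
  fix x :: real assume x: "x \<in> unit_ivl"
  have "primitive g x = primitive g 0"
  proof (rule continuous_invariant_constant[where h = "primitive g"])
    show "continuous_on unit_ivl (primitive g)"
      by (rule continuous_on_subset[OF continuous_on_primitive[OF assms(2)]]) auto
    show "primitive g (f t) = primitive g t" if t: "t \<in> unit_ivl" for t
    proof -
      obtain i where i: "i < r" "\<beta> i \<le> t" "t < \<beta> (Suc i)" using piece_cases[OF t] by blast
      then show ?thesis
        using primitive_cocycle[OF assms(1-3), of i t] translation[OF i] zero[of i] by simp
    qed
  qed (use x in auto)
  then show "primitive g x = 0" by (simp add: primitive_0)
qed

text \<open>Nonnegativity makes the primitive monotone, so an interval of zeros is a flat stretch
  and the plateau argument applies; equal end values then squeeze the primitive to 0.\<close>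

lemma nonneg_invariant_zero_on_interval:
  fixes g :: "real \<Rightarrow> real"
  assumes g: "g \<in> borel_measurable borel" "set_integrable lborel {0..1} g" "shift_invariant g"
    and nonneg: "\<And>x. 0 \<le> g x"
    and ab: "0 \<le> a" "a < b" "b \<le> 1" and zero: "AE x in lborel. x \<in> {a..b} \<longrightarrow> g x = 0"
  shows "AE x in lborel. x \<in> unit_ivl \<longrightarrow> g x = 0"
proof (rule AE_unit_if_primitive_zero[OF g(2)])
  have mono: "mono_on {0..1} (primitive g)" by (rule mono_on_primitive[OF g(2) nonneg])
  have "primitive g b - primitive g a = (LINT t:{a..b}|lborel. g t)"
    by (rule primitive_diff[OF g(2)]) (use ab in auto)
  also have "\<dots> = (LINT t:{a..b}|lborel. 0)"
    by (rule set_lebesgue_integral_cong_AE) (use g(1) zero in auto)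
  finally have "primitive g a = primitive g b" by simp
  then have "primitive g 0 = primitive g 1"
    using ab
    by (intro flat_somewhere_imp_constant[OF continuous_on_primitive[OF g(2)] mono
          primitive_cocycle[OF g], of a b]) auto
  then show "primitive g x = 0" if "x \<in> unit_ivl" for x
    using mono_onD[OF mono, of 0 x] mono_onD[OF mono, of x 1] that primitive_0[of g] by auto
qed

lemma invariant_function_finite_range:
  fixes g :: "real \<Rightarrow> real"
  assumes g [measurable]: "g \<in> borel_measurable borel" and inv: "shift_invariant g"
    and nonneg: "\<And>x. 0 \<le> g x"
  obtains F :: "real set" where "finite F" "AE x in lborel. x \<in> unit_ivl \<longrightarrow> g x \<in> F"
proof -
  \<comment> \<open>This bounds the function, so that all powers are integrable, and is undone by
    \<open>z / (1 - z)\<close>.\<close>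
  define s where "s x = g x / (1 + g x)" for x
  have [measurable]: "s \<in> borel_measurable borel" unfolding s_def by measurable
  have s01: "0 \<le> s x" "s x < 1" for x using nonneg[of x] by (auto simp: s_def)
  have int: "set_integrable lborel {0..1} (\<lambda>x. s x ^ k)" for k
  proof (rule set_integrable_bound)
    show "set_integrable lborel {0..1 :: real} (\<lambda>_. 1 :: real)"
      by (simp add: set_integrable_def)
    show "AE x in lborel. x \<in> {0..1} \<longrightarrow> norm (s x ^ k) \<le> norm (1 :: real)"
      using s01 by (auto simp: power_le_one less_imp_le)
  qed (auto simp: set_borel_measurable_def)
  define A where "A i k = displacement (\<lambda>x. s x ^ k) i" for i k
  \<comment> \<open>There are \<open>r + 1\<close> coefficients, for the powers 0 to
    \<open>r\<close>, against \<open>r\<close> displacement equations.\<close>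
  obtain c where c: "\<exists>k\<in>{..r}. c k \<noteq> 0" "\<And>i. i < r \<Longrightarrow> (\<Sum>k\<le>r. A i k * c k) = 0"
    using homogeneous_system_nontrivial_solution[of "{..r}" r A] by auto
  define q where "q x = (\<Sum>k\<le>r. c k * s x ^ k)" for x
  have [measurable]: "q \<in> borel_measurable borel" unfolding q_def by measurable
  have qint: "set_integrable lborel {0..1} q"
    using int unfolding q_def set_integrable_def by (auto simp: sum_distrib_left mult.left_commute)
  have prim: "primitive q x = (\<Sum>k\<le>r. c k * primitive (\<lambda>x. s x ^ k) x)" if "x \<in> {0..1}" for x
  proof -
    have "integrable lborel (\<lambda>t. indicator {0..x} t *\<^sub>R (s t ^ k))" for k
      using set_integrable_subset[OF int, of "{0..x}"] that by (auto simp: set_integrable_def)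
    then have "(LINT t|lborel. (\<Sum>k\<le>r. c k * (indicator {0..x} t *\<^sub>R s t ^ k))) = (\<Sum>k\<le>r. c k * primitive (\<lambda>x. s x ^ k) x)"
      unfolding primitive_def set_lebesgue_integral_def
      by (subst Bochner_Integration.integral_sum) auto
    then show ?thesis
      unfolding primitive_def set_lebesgue_integral_def q_def
      by (simp add: sum_distrib_left mult.left_commute)
  qed
  have "AE x in lborel. x \<in> unit_ivl \<longrightarrow> q x = 0"
  proof (rule AE_zero_if_displacement_zero)
    show "shift_invariant q"
      unfolding q_def s_def by (rule shift_invariant_comp[OF inv])
    show "displacement q i = 0" if i: "i < r" for i
    proof -
      have "displacement q i = (\<Sum>k\<le>r. A i k * c k)"
        using prim[of "\<beta> i"] prim[of "\<beta> i + \<gamma> i"] beta_bounds[of i] shift_bounds[of i "\<beta> i"] beta_less_Suc[of i] i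
        by (simp add: displacement_def A_def sum_subtractf[symmetric] algebra_simps)
      then show ?thesis using c(2)[OF i] by simp
    qed
  qed (use qint in auto)
  moreover define Z where "Z = {z. (\<Sum>k\<le>r. c k * z ^ k) = 0}"
  ultimately have "AE x in lborel. x \<in> unit_ivl \<longrightarrow> s x \<in> Z"
    by (simp add: q_def)
  moreover have "g x = s x / (1 - s x)" for x
    using nonneg[of x] by (simp add: s_def field_simps)
  ultimately have "AE x in lborel. x \<in> unit_ivl \<longrightarrow> g x \<in> (\<lambda>z. z / (1 - z)) ` Z"
    by (auto elim!: eventually_mono)
  moreover have "finite Z" unfolding Z_def using c(1) polyfun_finite_roots[of c r] by auto
  ultimately show thesis using that by blast
qed

end

subsection \<open>Invariant measures and their densities\<close>

lemma sets_leb_iff: "A \<in> sets leb \<longleftrightarrow> A \<subseteq> unit_ivl \<and> A \<in> sets borel"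
  by (auto simp: sets_restrict_space_iff)

lemma emeasure_leb: "A \<subseteq> unit_ivl \<Longrightarrow> emeasure leb A = emeasure lborel A"
  by (rule emeasure_restrict_space) auto

lemma prob_space_leb: "prob_space leb"
  by (rule prob_spaceI) (simp add: space_restrict_space emeasure_leb)

section \<open>Lebesgue measure is preserved by an interval exchange\<close>

context interval_exchange_data
begin

abbreviation piece :: "nat \<Rightarrow> real set" where
  "piece i \<equiv> {\<beta> i..<\<beta> (Suc i)}"

lemma disjoint_pieces: "disjoint_family_on piece {..<r}"
proof -
  have "piece i \<inter> piece j = {}" if "i < j" "j < r" for i j
    using beta_mono[of "Suc i" j] that by auto
  then show ?thesis
    unfolding disjoint_family_on_def by (metis Int_commute lessThan_iff linorder_neqE_nat)
qed

lemma vimage_eq: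
  "f -` A \<inter> unit_ivl = (\<Union>i<r. piece i \<inter> (\<lambda>x. x + \<gamma> i) -` A)"
proof (intro equalityI subsetI)
  fix x assume x: "x \<in> f -` A \<inter> unit_ivl"
  then obtain i where "i < r" "\<beta> i \<le> x" "x < \<beta> (Suc i)" using piece_cases[of x] by blast
  with x show "x \<in> (\<Union>i<r. piece i \<inter> (\<lambda>x. x + \<gamma> i) -` A)"
    using translation[of i x] by auto
next
  fix x assume "x \<in> (\<Union>i<r. piece i \<inter> (\<lambda>x. x + \<gamma> i) -` A)"
  then obtain i where "i < r" "\<beta> i \<le> x" "x < \<beta> (Suc i)" "x + \<gamma> i \<in> A" by auto
  then show "x \<in> f -` A \<inter> unit_ivl"
    using translation[of i x] piece_in_unit[of i x] by simp
qed

lemma measurable_interval_exchange: "f \<in> measurable leb leb"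
proof (rule measurableI)
  show "f x \<in> space leb" if "x \<in> space leb" for x
    using maps_to that by (simp add: space_restrict_space)
  fix A assume A: "A \<in> sets leb"
  then have [measurable]: "A \<in> sets borel" by (simp add: sets_leb_iff)
  have "piece i \<inter> (\<lambda>x. x + \<gamma> i) -` A \<in> sets borel" for i
    using measurable_sets[of "\<lambda>x. x + \<gamma> i" borel borel A] by auto
  then have "f -` A \<inter> unit_ivl \<in> sets borel"
    unfolding vimage_eq by blast
  then show "f -` A \<inter> space leb \<in> sets leb"
    by (simp add: space_restrict_space sets_leb_iff)
qed

lemma emeasure_lborel_shift:
  fixes A :: "real set"
  assumes "A \<in> sets borel"
  shows "emeasure lborel ((\<lambda>x. x + c) -` A) = emeasure lborel A"
proof -
  have "emeasure lborel A = emeasure (distr lborel borel ((+) c)) A"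
    by (simp add: lborel_distr_plus)
  also have "\<dots> = emeasure lborel ((+) c -` A)"
    using assms by (subst emeasure_distr) auto
  also have "(+) c -` A = (\<lambda>x. x + c) -` A" by (auto simp: add.commute)
  finally show ?thesis by simp
qed

text \<open>By surjectivity the translated parts \<open>Q i\<close> of the preimage cover
  \<open>A\<close>, while the parts \<open>P i\<close> themselves are disjoint. Overlaps among the
  \<open>Q i\<close> are not excluded here, hence an inequality.\<close>

lemma emeasure_le_vimage:
  assumes A: "A \<in> sets leb"
  shows "emeasure leb A \<le> emeasure leb (f -` A \<inter> unit_ivl)"
proof -
  have AI: "A \<subseteq> unit_ivl" and [measurable]: "A \<in> sets borel" using A by (auto simp: sets_leb_iff)
  define P where "P i = piece i \<inter> (\<lambda>x. x + \<gamma> i) -` A" for i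
  define Q where "Q i = (\<lambda>x. x + (- \<gamma> i)) -` P i" for i
  have P: "P i \<in> sets borel" for i
    unfolding P_def using measurable_sets[of "\<lambda>x. x + \<gamma> i" borel borel A] by auto
  have Q: "Q i \<in> sets borel" for i
    unfolding Q_def using measurable_sets[of "\<lambda>x. x + (- \<gamma> i)" borel borel "P i"] P by auto
  have "A \<subseteq> (\<Union>i<r. Q i)"
  proof
    fix y assume y: "y \<in> A"
    then obtain x where x: "x \<in> unit_ivl" "y = f x" using AI surj by blast
    then obtain i where i: "i < r" "\<beta> i \<le> x" "x < \<beta> (Suc i)" using piece_cases by blast
    with x y show "y \<in> (\<Union>i<r. Q i)"
      using translation[OF i] by (intro UN_I[of i]) (auto simp: Q_def P_def)
  qed
  then have "emeasure lborel A \<le> emeasure lborel (\<Union>i<r. Q i)"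
    using Q by (intro emeasure_mono) auto
  also have "\<dots> \<le> (\<Sum>i<r. emeasure lborel (Q i))"
    using Q by (intro emeasure_subadditive_finite) auto
  also have "\<dots> = (\<Sum>i<r. emeasure lborel (P i))"
    unfolding Q_def by (simp only: emeasure_lborel_shift[OF P])
  also have "\<dots> = emeasure lborel (\<Union>i<r. P i)"
  proof (rule sum_emeasure)
    show "disjoint_family_on P {..<r}"
      using disjoint_pieces unfolding disjoint_family_on_def P_def by blast
  qed (use P in auto)
  finally show ?thesis
    using AI by (simp add: emeasure_leb vimage_eq[symmetric] P_def)
qed

text \<open>Applying the inequality to \<open>A\<close> and to its complement forces equality, because the total
  mass is 1.\<close>

lemma emeasure_vimage:
  assumes A: "A \<in> sets leb"
  shows "emeasure leb (f -` A \<inter> unit_ivl) = emeasure leb A"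
proof -
  interpret prob_space leb by (rule prob_space_leb)
  have space: "space leb = unit_ivl" by (simp add: space_restrict_space)
  let ?B = "f -` A \<inter> unit_ivl"
  have B: "?B \<in> sets leb"
    using measurable_sets[OF measurable_interval_exchange A] by (simp add: space)
  have "f -` (space leb - A) \<inter> unit_ivl = space leb - ?B"
    using maps_to by (auto simp: space)
  then have "measure leb (space leb - A) \<le> measure leb (space leb - ?B)"
    using emeasure_le_vimage[OF sets.compl_sets[OF A]] by (simp add: emeasure_eq_measure)
  then have "measure leb ?B \<le> measure leb A"
    using prob_compl[OF A] prob_compl[OF B] by simp
  then show ?thesis
    using emeasure_le_vimage[OF A] by (auto simp: emeasure_eq_measure intro: antisym)
qed

end

section \<open>The density as a real function on the line\<close>

text \<open>Extending by zero off the interval allows integrals and almost everywhere statements to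
  refer to \<open>lborel\<close>.\<close>

definition radon_nikodym_density :: "real measure \<Rightarrow> real \<Rightarrow> real" where
  "radon_nikodym_density \<mu> x = (if x \<in> unit_ivl then enn2real (RN_deriv leb \<mu> x) else 0)"

context
  fixes \<mu> :: "real measure"
  assumes sets_mu: "sets \<mu> = sets leb" and prob: "prob_space \<mu>"
    and ac: "absolutely_continuous leb \<mu>"
begin

lemma space_mu: "space \<mu> = unit_ivl"
  using sets_eq_imp_space_eq[OF sets_mu] by (simp add: space_restrict_space)

lemma radon_nikodym_density_nonneg: "0 \<le> radon_nikodym_density \<mu> x"
  by (simp add: radon_nikodym_density_def)

lemma borel_measurable_radon_nikodym_density [measurable]:
  "radon_nikodym_density \<mu> \<in> borel_measurable borel"
proof -
  have "(\<lambda>x. enn2real (RN_deriv leb \<mu> x)) \<in> borel_measurable (restrict_space borel unit_ivl)"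
    using borel_measurable_RN_deriv[of leb \<mu>]
    by (auto intro!: borel_measurable_enn2real simp: measurable_cong_sets[OF restrict_space_sets_cong[OF refl sets_lborel] refl])
  then have "(\<lambda>x. indicator unit_ivl x *\<^sub>R enn2real (RN_deriv leb \<mu> x)) \<in> borel_measurable borel"
    by (subst (asm) borel_measurable_restrict_space_iff) auto
  moreover have "radon_nikodym_density \<mu> = (\<lambda>x. indicator unit_ivl x *\<^sub>R enn2real (RN_deriv leb \<mu> x))"
    by (auto simp: radon_nikodym_density_def indicator_def)
  ultimately show ?thesis by simp
qed

lemma emeasure_eq_radon_nikodym_density:
  assumes A: "A \<in> sets borel" "A \<subseteq> unit_ivl"
  shows "emeasure \<mu> A = (\<integral>\<^sup>+x. ennreal (radon_nikodym_density \<mu> x) * indicator A x \<partial>lborel)"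
proof -
  interpret leb: prob_space leb by (rule prob_space_leb)
  interpret mu: prob_space \<mu> by (rule prob)
  have A': "A \<in> sets leb" using A by (simp add: sets_leb_iff)
  have [measurable]: "A \<in> sets borel" by fact
  \<comment> \<open>Finiteness almost everywhere lets \<open>enn2real\<close> be inserted without
    changing the integral.\<close>
  have fin: "AE x in leb. RN_deriv leb \<mu> x \<noteq> \<infinity>"
    by (rule leb.RN_deriv_finite[OF mu.sigma_finite_measure_axioms ac sets_mu])
  have "emeasure \<mu> A = emeasure (density leb (RN_deriv leb \<mu>)) A"
    using leb.density_RN_deriv[OF ac sets_mu] by simp
  also have "\<dots> = (\<integral>\<^sup>+x. RN_deriv leb \<mu> x * indicator A x \<partial>leb)"
    using A' by (simp add: emeasure_density)
  also have "\<dots> = (\<integral>\<^sup>+x. ennreal (enn2real (RN_deriv leb \<mu> x)) * indicator A x \<partial>leb)"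
    using fin by (intro nn_integral_cong_AE) (auto elim!: eventually_mono simp: less_top)
  also have "\<dots> = (\<integral>\<^sup>+x. ennreal (enn2real (RN_deriv leb \<mu> x)) * indicator A x * indicator unit_ivl x \<partial>lborel)"
    by (rule nn_integral_restrict_space) auto
  also have "\<dots> = (\<integral>\<^sup>+x. ennreal (radon_nikodym_density \<mu> x) * indicator A x \<partial>lborel)"
    using A(2) by (intro nn_integral_cong) (auto simp: radon_nikodym_density_def indicator_def)
  finally show ?thesis .
qed

lemma nn_integral_radon_nikodym_density:
  "(\<integral>\<^sup>+x. ennreal (radon_nikodym_density \<mu> x) \<partial>lborel) = 1"
proof -
  have "(\<integral>\<^sup>+x. ennreal (radon_nikodym_density \<mu> x) \<partial>lborel)
      = (\<integral>\<^sup>+x. ennreal (radon_nikodym_density \<mu> x) * indicator unit_ivl x \<partial>lborel)"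
    by (intro nn_integral_cong) (auto simp: radon_nikodym_density_def indicator_def)
  also have "\<dots> = emeasure \<mu> (space \<mu>)"
    by (simp add: emeasure_eq_radon_nikodym_density space_mu)
  finally show ?thesis using prob by (simp add: prob_space.emeasure_space_1)
qed

lemma set_integrable_radon_nikodym_density:
  "set_integrable lborel {0..1} (radon_nikodym_density \<mu>)"
proof -
  have "integrable lborel (radon_nikodym_density \<mu>)"
    by (rule integrableI_nonneg)
      (simp_all add: radon_nikodym_density_nonneg nn_integral_radon_nikodym_density)
  then show ?thesis
    unfolding set_integrable_def by (intro integrable_mult_indicator) auto
qed

lemma density_class_iff:
  "\<phi> \<in> density_class \<mu> \<longleftrightarrow> (AE x in lborel. x \<in> unit_ivl \<longrightarrow> \<phi> x = radon_nikodym_density \<mu> x)"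
  unfolding density_class_def radon_nikodym_density_def
  by (simp add: AE_restrict_space_iff cong: imp_cong)

text \<open>The measure is then a multiple of Lebesgue measure, and comparing total masses makes the
  factor 1.\<close>

lemma eq_leb_if_density_constant:
  assumes c: "AE x in lborel. x \<in> unit_ivl \<longrightarrow> radon_nikodym_density \<mu> x = c"
  shows "\<mu> = leb"
proof -
  have em: "emeasure \<mu> A = ennreal c * emeasure leb A" if "A \<in> sets leb" for A
  proof -
    have A: "A \<in> sets borel" "A \<subseteq> unit_ivl" using that by (auto simp: sets_leb_iff)
    have "emeasure \<mu> A = (\<integral>\<^sup>+x. ennreal (radon_nikodym_density \<mu> x) * indicator A x \<partial>lborel)"
      by (rule emeasure_eq_radon_nikodym_density[OF A])
    also have "\<dots> = (\<integral>\<^sup>+x. ennreal c * indicator A x \<partial>lborel)"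
      using c by (intro nn_integral_cong_AE) (use A(2) in \<open>auto elim!: eventually_mono simp: indicator_def\<close>)
    also have "\<dots> = ennreal c * emeasure leb A"
      using A by (simp add: nn_integral_cmult_indicator emeasure_leb)
    finally show ?thesis .
  qed
  have "ennreal c = 1"
    using em[of unit_ivl] prob prob_space.emeasure_space_1[OF prob]
    by (simp add: space_mu sets_leb_iff emeasure_leb)
  then show ?thesis using em sets_mu by (intro measure_eqI) auto
qed

end

section \<open>Invariance of the density\<close>

context interval_exchange_data
begin

text \<open>Invariance of \<open>\<mu>\<close> concerns preimages. It is first transferred to
  translates of subsets of a piece, and uniqueness of densities then compares the density with its
  shift on that piece.\<close>

lemma shift_invariant_radon_nikodym_density:
  assumes mu: "\<mu> \<in> ac_invariant_measures f"
  shows "shift_invariant (radon_nikodym_density \<mu>)"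
  unfolding shift_invariant_def
proof (intro allI impI)
  have sets_mu: "sets \<mu> = sets leb"
    using mu by (simp add: ac_invariant_measures_def cong: restrict_space_sets_cong)
  have prob: "prob_space \<mu>" and ac: "absolutely_continuous leb \<mu>"
    and meas: "f \<in> measurable \<mu> \<mu>" and distr: "distr \<mu> \<mu> f = \<mu>"
    using mu by (auto simp: ac_invariant_measures_def)
  note density = emeasure_eq_radon_nikodym_density[OF sets_mu prob ac]
  interpret leb: prob_space leb by (rule prob_space_leb)
  interpret mu: prob_space \<mu> by (rule prob)
  have [measurable]: "radon_nikodym_density \<mu> \<in> borel_measurable borel"
    by (rule borel_measurable_radon_nikodym_density[OF sets_mu prob ac])
  fix i assume i: "i < r"
  have shift: "emeasure \<mu> ((\<lambda>x. x - \<gamma> i) -` B) = emeasure \<mu> B"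
    if B: "B \<in> sets borel" "B \<subseteq> piece i" for B
  proof -
    let ?C = "(\<lambda>x. x - \<gamma> i) -` B"
    have BI: "B \<subseteq> unit_ivl" using B(2) piece_in_unit[OF i] by auto
    have CI: "?C \<subseteq> unit_ivl"
    proof
      fix y assume "y \<in> ?C"
      then show "y \<in> unit_ivl" using shift_in_unit[OF i, of "y - \<gamma> i"] B(2) by auto
    qed
    have C: "?C \<in> sets leb"
      using CI measurable_sets[of "\<lambda>x. x - \<gamma> i" borel borel B] B by (auto simp: sets_leb_iff)
    let ?P = "f -` ?C \<inter> unit_ivl"
    have P: "?P \<in> sets leb"
      using measurable_sets[OF measurable_interval_exchange C] by (simp add: space_restrict_space)
    have Bleb: "B \<in> sets leb" using B BI by (simp add: sets_leb_iff)
    have BP: "B \<subseteq> ?P"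
      using B(2) BI translation[OF i] by auto
    have "emeasure leb ?P = emeasure leb B"
      using emeasure_vimage[OF C] emeasure_lborel_shift[of B "- \<gamma> i"] B(1) CI BI by (simp add: emeasure_leb)
    \<comment> \<open>The preimage of the translate \<open>?C\<close> contains \<open>B\<close> and
      has the same Lebesgue measure, so the excess is null for Lebesgue measure and, by absolute
      continuity, for \<open>\<mu>\<close>.\<close>
    then have "emeasure leb (?P - B) = 0"
      using P Bleb BP by (subst emeasure_Diff) auto
    then have "?P - B \<in> null_sets leb" using P Bleb by auto
    then have "?P - B \<in> null_sets \<mu>" using ac by (auto simp: absolutely_continuous_def)
    then have "emeasure \<mu> (B \<union> (?P - B)) = emeasure \<mu> B"
      using Bleb sets_mu by (intro emeasure_Un_null_set) auto
    moreover have "B \<union> (?P - B) = ?P" using BP by blast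
    moreover have "emeasure \<mu> ?C = emeasure \<mu> ?P"
      using emeasure_distr[OF meas, of ?C] distr C sets_mu by (simp add: space_mu[OF sets_mu prob ac])
    ultimately show ?thesis by simp
  qed
  let ?g = "\<lambda>x. ennreal (radon_nikodym_density \<mu> x)"
  have "density lborel (\<lambda>x. ?g (x + \<gamma> i) * indicator (piece i) x) = density lborel (\<lambda>x. ?g x * indicator (piece i) x)"
  proof (rule measure_eqI)
    fix A assume "A \<in> sets (density lborel (\<lambda>x. ?g (x + \<gamma> i) * indicator (piece i) x))"
    then have A[measurable]: "A \<in> sets borel" by simp
    let ?B = "A \<inter> piece i" and ?C = "(\<lambda>x. x - \<gamma> i) -` (A \<inter> piece i)"
    have B: "?B \<in> sets borel" "?B \<subseteq> unit_ivl" using piece_in_unit[OF i] by auto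
    have C: "?C \<in> sets borel"
      using measurable_sets[of "\<lambda>x. x - \<gamma> i" borel borel ?B] B by auto
    have CI: "?C \<subseteq> unit_ivl"
    proof
      fix y assume "y \<in> ?C"
      then show "y \<in> unit_ivl" using shift_in_unit[OF i, of "y - \<gamma> i"] by auto
    qed
    have "emeasure (density lborel (\<lambda>x. ?g (x + \<gamma> i) * indicator (piece i) x)) A
        = (\<integral>\<^sup>+x. ?g (x + \<gamma> i) * indicator (piece i) x * indicator A x \<partial>lborel)"
      by (simp add: emeasure_density)
    also have "\<dots> = (\<integral>\<^sup>+x. ?g (\<gamma> i + 1 * x) * indicator ?C (\<gamma> i + 1 * x) \<partial>lborel)"
      by (intro nn_integral_cong) (auto simp: indicator_def add.commute)
    also have "\<dots> = (\<integral>\<^sup>+x. ?g x * indicator ?C x \<partial>lborel)"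
      using C by (subst (2) nn_integral_real_affine[where c = 1 and t = "\<gamma> i"]) auto
    also have "\<dots> = emeasure \<mu> ?C" by (rule density[OF C CI, symmetric])
    also have "\<dots> = emeasure \<mu> ?B" by (rule shift) (use B in auto)
    also have "\<dots> = (\<integral>\<^sup>+x. ?g x * indicator ?B x \<partial>lborel)" by (rule density[OF B])
    also have "\<dots> = (\<integral>\<^sup>+x. ?g x * indicator (piece i) x * indicator A x \<partial>lborel)"
      by (intro nn_integral_cong) (auto simp: indicator_def)
    also have "\<dots> = emeasure (density lborel (\<lambda>x. ?g x * indicator (piece i) x)) A"
      by (simp add: emeasure_density)
    finally show "emeasure (density lborel (\<lambda>x. ?g (x + \<gamma> i) * indicator (piece i) x)) A
        = emeasure (density lborel (\<lambda>x. ?g x * indicator (piece i) x)) A" .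
  qed simp
  then have "AE x in lborel. ?g (x + \<gamma> i) * indicator (piece i) x = ?g x * indicator (piece i) x"
    by (intro sigma_finite_measure.density_unique[OF lborel.sigma_finite_measure_axioms]) auto
  then show "AE x in lborel. \<beta> i \<le> x \<and> x < \<beta> (Suc i) \<longrightarrow>
      radon_nikodym_density \<mu> (x + \<gamma> i) = radon_nikodym_density \<mu> x"
    by eventually_elim
      (auto simp: indicator_def ennreal_inj radon_nikodym_density_nonneg[OF sets_mu prob ac])
qed

end

section \<open>Simple density, discontinuity and support\<close>

text \<open>Near a continuity point the values come closer to \<open>\<phi> x\<close> than any other
  member of the finite set \<open>F\<close>, so almost all of them equal
  \<open>\<phi> x\<close>.\<close>

lemma continuous_AE_finite_range_constant:
  fixes \<phi> :: "real \<Rightarrow> real"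
  assumes F: "finite F" "AE x in lborel. x \<in> unit_ivl \<longrightarrow> \<phi> x \<in> F"
    and x: "x \<in> unit_ivl" and cont: "continuous (at x within unit_ivl) \<phi>"
  obtains b c where "x < b" "b \<le> 1" "AE t in lborel. t \<in> {x..b} \<longrightarrow> \<phi> t = c"
proof -
  obtain e where e: "e > 0" "\<And>c. c \<in> F \<Longrightarrow> c \<noteq> \<phi> x \<Longrightarrow> e \<le> dist (\<phi> x) c"
    using finite_set_avoid[OF F(1), of "\<phi> x"] by (metis dist_commute)
  obtain d where d: "d > 0" "\<And>t. t \<in> unit_ivl \<Longrightarrow> dist t x < d \<Longrightarrow> dist (\<phi> t) (\<phi> x) < e"
    using cont e(1) unfolding continuous_within_eps_delta by (auto simp: Bex_def)
  \<comment> \<open>An interval to the right of \<open>x\<close> also serves \<open>x = 0\<close>;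
    the minimum keeps it inside the unit interval and within distance \<open>d\<close>.\<close>
  define b where "b = min (x + d / 2) ((x + 1) / 2)"
  have b: "x < b" "b < 1" "b < x + d" using x d(1) by (auto simp: b_def min_def field_simps)
  have "AE t in lborel. t \<in> {x..b} \<longrightarrow> \<phi> t = \<phi> x"
    using F(2)
  proof eventually_elim
    case (elim t)
    show ?case
    proof
      assume t: "t \<in> {x..b}"
      then have "t \<in> unit_ivl" "dist t x < d" using x b by (auto simp: dist_real_def)
      with elim d(2)[of t] e(2)[of "\<phi> t"] show "\<phi> t = \<phi> x" by (force simp: dist_commute)
    qed
  qed
  with b that show thesis by (meson less_imp_le)
qed

context transitive_interval_exchange
begin

context
  fixes \<mu> :: "real measure"
  assumes mu: "\<mu> \<in> ac_invariant_measures f"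
begin

lemma mu_facts: "sets \<mu> = sets leb" "prob_space \<mu>" "absolutely_continuous leb \<mu>"
  using mu by (simp_all add: ac_invariant_measures_def cong: restrict_space_sets_cong)

lemmas density_facts =
  borel_measurable_radon_nikodym_density[OF mu_facts] set_integrable_radon_nikodym_density[OF mu_facts]
  shift_invariant_radon_nikodym_density[OF mu]

lemma density_finite_range:
  obtains F where "finite F" "AE x in lborel. x \<in> unit_ivl \<longrightarrow> radon_nikodym_density \<mu> x \<in> F"
  using invariant_function_finite_range[OF density_facts(1,3) radon_nikodym_density_nonneg[OF mu_facts]] .

lemma density_simple: "\<exists>\<phi>\<in>density_class \<mu>. simple_function leb \<phi>"
proof -
  obtain F where F: "finite F" "AE x in lborel. x \<in> unit_ivl \<longrightarrow> radon_nikodym_density \<mu> x \<in> F"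
    by (rule density_finite_range)
  \<comment> \<open>Values outside \<open>F\<close> occur only on a null set; resetting them to 0
    gives a representative with finite range.\<close>
  define \<phi> where "\<phi> x = (if radon_nikodym_density \<mu> x \<in> F then radon_nikodym_density \<mu> x else 0)" for x
  note [measurable] = density_facts(1)
  have [measurable]: "F \<in> sets borel" by (rule borel_closed[OF finite_imp_closed[OF F(1)]])
  have "\<phi> \<in> borel_measurable borel" unfolding \<phi>_def by measurable
  then have "\<phi> \<in> borel_measurable leb"
    by (intro measurable_restrict_space1) simp
  moreover have "finite (\<phi> ` space leb)"
    by (rule finite_subset[of _ "insert 0 F"]) (use F(1) in \<open>auto simp: \<phi>_def\<close>)
  ultimately have "simple_function leb \<phi>" by (rule simple_function_borel_measurable)
  moreover have "\<phi> \<in> density_class \<mu>"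
    unfolding density_class_iff[OF mu_facts] using F(2) by eventually_elim (simp add: \<phi>_def)
  ultimately show ?thesis by blast
qed

lemma density_discontinuous:
  assumes ne: "\<mu> \<noteq> leb" and \<phi>: "\<phi> \<in> density_class \<mu>" and x: "x \<in> unit_ivl"
  shows "\<not> continuous (at x within unit_ivl) \<phi>"
proof
  let ?\<rho> = "radon_nikodym_density \<mu>"
  assume cont: "continuous (at x within unit_ivl) \<phi>"
  have eq: "AE t in lborel. t \<in> unit_ivl \<longrightarrow> \<phi> t = ?\<rho> t"
    using \<phi> by (simp add: density_class_iff[OF mu_facts])
  obtain F where F: "finite F" "AE x in lborel. x \<in> unit_ivl \<longrightarrow> ?\<rho> x \<in> F"
    by (rule density_finite_range)
  have "AE t in lborel. t \<in> unit_ivl \<longrightarrow> \<phi> t \<in> F"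
    using eq F(2) by eventually_elim auto
  from continuous_AE_finite_range_constant[OF F(1) this x cont] obtain b c
    where b: "x < b" "b \<le> 1" and c: "AE t in lborel. t \<in> {x..b} \<longrightarrow> \<phi> t = c" by blast
  \<comment> \<open>As a function of the density this indicator is invariant; vanishing on one
    interval, it vanishes almost everywhere, and the density would be the constant
    \<open>c\<close>.\<close>
  define g where "g = (\<lambda>t. indicator (- {c}) (?\<rho> t) :: real)"
  note [measurable] = density_facts(1)
  have g: "g \<in> borel_measurable borel" unfolding g_def by measurable
  have "AE t in lborel. t \<in> unit_ivl \<longrightarrow> g t = 0"
  proof (rule nonneg_invariant_zero_on_interval[OF g])
    show "set_integrable lborel {0..1} g"
    proof (rule set_integrable_bound)
      show "set_integrable lborel {0..1 :: real} (\<lambda>_. 1 :: real)" by (simp add: set_integrable_def)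
      show "set_borel_measurable lborel {0..1} g" using g by (simp add: set_borel_measurable_def)
      show "AE t in lborel. t \<in> {0..1} \<longrightarrow> norm (g t) \<le> norm (1 :: real)"
        by (simp add: g_def indicator_def)
    qed
    show "shift_invariant g" unfolding g_def by (rule shift_invariant_comp[OF density_facts(3)])
    \<comment> \<open>The case \<open>b = 1\<close> lies outside the unit interval, where
      \<open>\<phi>\<close> and the density need not agree.\<close>
    have "AE t in lborel. t \<noteq> b" by (rule AE_lborel_singleton)
    then show "AE t in lborel. t \<in> {x..b} \<longrightarrow> g t = 0"
      using eq c by eventually_elim (use x b in \<open>auto simp: g_def\<close>)
  qed (use x b in \<open>auto simp: g_def\<close>)
  then have "AE t in lborel. t \<in> unit_ivl \<longrightarrow> ?\<rho> t = c"
    by eventually_elim (auto simp: g_def indicator_def split: if_splits)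
  with ne show False using eq_leb_if_density_constant[OF mu_facts] by blast
qed

text \<open>A ball of measure zero would make the density vanish on an interval, hence almost
  everywhere, against total mass 1.\<close>

lemma measure_support_eq: "measure_support \<mu> = unit_ivl"
proof -
  let ?\<rho> = "radon_nikodym_density \<mu>"
  have "emeasure \<mu> (ball c \<epsilon> \<inter> unit_ivl) \<noteq> 0" if x: "x \<in> unit_ivl" "x \<in> ball c \<epsilon>" for x c \<epsilon>
  proof
    let ?B = "ball c \<epsilon> \<inter> unit_ivl"
    have "ball c \<epsilon> \<in> sets borel" by simp
    then have "?B \<in> sets lborel" by (simp add: sets.Int)
    then have meas: "(\<lambda>t. ennreal (?\<rho> t) * indicator ?B t) \<in> borel_measurable lborel"
      using density_facts(1) by (intro borel_measurable_times_ennreal borel_measurable_indicator) auto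
    assume "emeasure \<mu> ?B = 0"
    then have "(\<integral>\<^sup>+t. ennreal (?\<rho> t) * indicator ?B t \<partial>lborel) = 0"
      by (simp add: emeasure_eq_radon_nikodym_density[OF mu_facts])
    then have zero: "AE t in lborel. ennreal (?\<rho> t) * indicator ?B t = 0"
      using meas by (simp only: nn_integral_0_iff_AE)
    \<comment> \<open>Chosen below both the right end of the ball and 1, so that
      \<open>[x, b]\<close> lies in \<open>?B\<close>.\<close>
    define b where "b = min ((x + (c + \<epsilon>)) / 2) ((x + 1) / 2)"
    have b: "x < b" "b < 1" "b < c + \<epsilon>" "c - \<epsilon> < x"
      using x by (auto simp: b_def dist_real_def min_def field_simps)
    have "AE t in lborel. t \<in> unit_ivl \<longrightarrow> ?\<rho> t = 0"
    proof (rule nonneg_invariant_zero_on_interval[OF density_facts])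
      show "AE t in lborel. t \<in> {x..b} \<longrightarrow> ?\<rho> t = 0"
        using zero
      proof eventually_elim
        case (elim t)
        have "t \<in> ?B" if "t \<in> {x..b}" using that x(1) b by (auto simp: dist_real_def)
        with elim show ?case using radon_nikodym_density_nonneg[OF mu_facts, of t] by (auto simp: ennreal_eq_0_iff)
      qed
    qed (use x b radon_nikodym_density_nonneg[OF mu_facts] in auto)
    then have "(\<integral>\<^sup>+t. ennreal (?\<rho> t) \<partial>lborel) = (\<integral>\<^sup>+t. 0 \<partial>(lborel :: real measure))"
      by (intro nn_integral_cong_AE) (auto elim!: eventually_mono simp: radon_nikodym_density_def)
    then show False by (simp add: nn_integral_radon_nikodym_density[OF mu_facts])
  qed
  then show ?thesis
    unfolding measure_support_def by (auto simp del: atLeastLessThan_iff simp: zero_less_iff_neq_zero)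
qed

end

end

theorem proposition1:
  fixes f :: "real \<Rightarrow> real" and \<mu> :: "real measure"
  assumes "interval_exchange f"
    and "topologically_transitive f"
    and "\<mu> \<in> ac_invariant_measures f"
    and "\<mu> \<noteq> leb"
  shows "(\<exists>\<phi>\<in>density_class \<mu>. simple_function leb \<phi>) \<and>
         (\<forall>\<phi>\<in>density_class \<mu>. \<forall>x\<in>unit_ivl. \<not> continuous (at x within unit_ivl) \<phi>) \<and>
         measure_support \<mu> = unit_ivl"
proof -
  obtain r :: nat and \<beta> \<gamma> :: "nat \<Rightarrow> real"
    where surj: "f ` unit_ivl = unit_ivl" and beta: "\<beta> 0 = 0" "\<beta> r = 1" "\<forall>i<r. \<beta> i < \<beta> (Suc i)"
      and translation: "\<forall>i\<in>{1..r}. \<forall>x. \<beta> (i - 1) \<le> x \<and> x < \<beta> i \<longrightarrow> f x = x + \<gamma> i"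
    using assms(1) unfolding interval_exchange_def by blast
  \<comment> \<open>The definition numbers the translations from 1, the locale from 0.\<close>
  interpret transitive_interval_exchange f r \<beta> "\<lambda>i. \<gamma> (Suc i)"
  proof
    fix i x assume "i < r" "\<beta> i \<le> x" "x < \<beta> (Suc i)"
    then show "f x = x + \<gamma> (Suc i)"
      using translation[rule_format, of "Suc i" x] by simp
  qed (use surj beta assms(2) in auto)
  show ?thesis
    using density_simple density_discontinuous measure_support_eq assms(3,4) by blast
qed

end
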